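(* Let $f:\mathbb{R}^n\to(-\infty,+\infty]$ and $g:\mathbb{R}^m\to(-\infty,+\infty]$ be proper, closed and convex, with $f$ $\sigma$-strongly convex for some $\sigma>0$, and let $\mathbf{A}$ be a real $m\times n$ matrix. Let $\mathbf{y}_*$ be a maximizer of the dual function $q$. Let $\{\mathbf{y}_k,\mathbf{w}_k\}$ be the sequence generated by the GFDPG method (defined in the context). Then for any $k\ge1$, $$q(\mathbf{y}_* )-q(\mathbf{y}_k)=\tilde q(\mathbf{y}_k)-\tilde q(\mathbf{y}_* )\le\frac{L_k\|\mathbf{y}_0-\mathbf{y}_*\|^2}{2T_{k-1}},$$ and $$\min\Big\{\{\|\mathbf{y}_i-\mathbf{w}_{i-1}\|\}_{i=1}^k,\ \|p_{L_k'}(\mathbf{y}_k)-\mathbf{y}_k\|\Big\}\le\frac{\|\mathbf{y}_0-\mathbf{y}_*\|}{\sqrt{\sum_{i=0}^{k-1}(T_i-t_i^2)+T_{k-1}}}$$ for any $L_k'$ that satisfies $\tilde q(p_{L_k'}(\mathbf{y}_k))\le Q_{L_k'}(p_{L_k'}(\mathbf{y}_k),\mathbf{y}_k)$, where $\mathbf{y}_i=p_{L_i}(\mathbf{w}_{i-1})$.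
   Context: Convex conjugates: $f^*(\mathbf{u})=\max_{\mathbf{x}}\{\langle\mathbf{u},\mathbf{x}\rangle-f(\mathbf{x})\}$, $g^*(\mathbf{y})=\max_{\mathbf{z}}\{\langle\mathbf{y},\mathbf{z}\rangle-g(\mathbf{z})\}$. Put $F(\mathbf{y}):=f^*(\mathbf{A}^\top\mathbf{y})$ (differentiable with Lipschitz gradient) and $G(\mathbf{y}):=g^*(-\mathbf{y})$. The dual function is $q(\mathbf{y}):=-F(\mathbf{y})-G(\mathbf{y})$, and $\tilde q:=-q=F+G$; $\mathbf{y}_*$ is equivalently a minimizer of $\tilde q$. For $L>0$ and $\mathbf{y},\mathbf{w}\in\mathbb{R}^m$, $$Q_L(\mathbf{y},\mathbf{w}):=F(\mathbf{w})+\langle\mathbf{y}-\mathbf{w},\nabla F(\mathbf{w})\rangle+\tfrac{L}{2}\|\mathbf{y}-\mathbf{w}\|^2+G(\mathbf{y}),\qquad p_L(\mathbf{w}):=\operatorname{argmin}_{\mathbf{y}}Q_L(\mathbf{y},\mathbf{w}).$$ $\|\cdot\|$ is the Euclidean norm. GFDPG method (with backtracking): given $L_0>0$, $\mathbf{y}_0=\mathbf{w}_0\in\mathbb{R}^m$, $t_0=T_0\in(0,1]$, for $k\ge1$: choose $L_k$ such that $L_{k-1}\le L_k$ and $\tilde q(p_{L_k}(\mathbf{w}_{k-1}))\le Q_{L_k}(p_{L_k}(\mathbf{w}_{k-1}),\mathbf{w}_{k-1})$; set $\mathbf{y}_k=p_{L_k}(\mathbf{w}_{k-1})$; choose $t_k$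 such that $t_k>0$ and $t_k^2\le T_k:=\sum_{i=0}^kt_i$; set $$\mathbf{w}_k=\mathbf{y}_k+\frac{(T_{k-1}-t_{k-1})t_k}{t_{k-1}T_k}(\mathbf{y}_k-\mathbf{y}_{k-1})+\frac{(t_{k-1}^2-T_{k-1})t_k}{t_{k-1}T_k}(\mathbf{y}_k-\mathbf{w}_{k-1}).$$
   Formalization: The second bound is stated only for L_k' ≥ L_k (the method's own monotonicity rule for the next constant); for L_k' < L_k satisfying the displayed condition the bound as written can fail. *)

theory Defs
  imports "HOL-Analysis.Analysis"
begin

text \<open>Convex analysis for functions with values in \<open>(-\<infinity>, +\<infinity>]\<close>, rendered as \<^typ>\<open>ereal\<close>-valued
  functions; the value \<open>-\<infinity>\<close> is excluded by \<open>ext_proper\<close>.\<close>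

definition ext_epigraph :: "('a \<Rightarrow> ereal) \<Rightarrow> ('a \<times> real) set" where
  "ext_epigraph h = {(x, r). h x \<le> ereal r}"

definition ext_proper :: "('a \<Rightarrow> ereal) \<Rightarrow> bool" where
  "ext_proper h \<longleftrightarrow> (\<forall>x. h x \<noteq> -\<infinity>) \<and> (\<exists>x. h x \<noteq> \<infinity>)"

definition ext_closed :: "('a::topological_space \<Rightarrow> ereal) \<Rightarrow> bool" where
  "ext_closed h \<longleftrightarrow> closed (ext_epigraph h)"

definition ext_convex :: "('a::real_vector \<Rightarrow> ereal) \<Rightarrow> bool" where
  "ext_convex h \<longleftrightarrow> convex (ext_epigraph h)"

definition ext_strongly_convex :: "real \<Rightarrow> ('a::real_normed_vector \<Rightarrow> ereal) \<Rightarrow> bool" where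
  "ext_strongly_convex \<sigma> h \<longleftrightarrow>
     (\<forall>x y. \<forall>\<theta>\<in>{0<..<1::real}.
        h (\<theta> *\<^sub>R x + (1 - \<theta>) *\<^sub>R y)
          \<le> ereal \<theta> * h x + ereal (1 - \<theta>) * h y - ereal (\<sigma> / 2 * \<theta> * (1 - \<theta>) * (norm (x - y))\<^sup>2))"

definition convex_conjugate :: "('a::real_inner \<Rightarrow> ereal) \<Rightarrow> 'a \<Rightarrow> ereal" where
  "convex_conjugate h u = (SUP x. ereal (u \<bullet> x) - h x)"

definition gradient :: "('a::real_inner \<Rightarrow> real) \<Rightarrow> 'a \<Rightarrow> 'a" where
  "gradient h x = (THE D. GDERIV h x :> D)"

definition dual_F :: "(real^'n \<Rightarrow> ereal) \<Rightarrow> real^'n^'m \<Rightarrow> real^'m \<Rightarrow> ereal" where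
  "dual_F f A y = convex_conjugate f (transpose A *v y)"

definition dual_G :: "(real^'m \<Rightarrow> ereal) \<Rightarrow> real^'m \<Rightarrow> ereal" where
  "dual_G g y = convex_conjugate g (- y)"

definition dual_q ::
  "(real^'n \<Rightarrow> ereal) \<Rightarrow> (real^'m \<Rightarrow> ereal) \<Rightarrow> real^'n^'m \<Rightarrow> real^'m \<Rightarrow> ereal" where
  "dual_q f g A y = - dual_F f A y - dual_G g y"

definition neg_dual_q ::
  "(real^'n \<Rightarrow> ereal) \<Rightarrow> (real^'m \<Rightarrow> ereal) \<Rightarrow> real^'n^'m \<Rightarrow> real^'m \<Rightarrow> ereal" where
  "neg_dual_q f g A y = - dual_q f g A y"

text \<open>For strongly convex, proper, closed \<open>f\<close> the function \<open>dual_F f A\<close> is finite everywhere and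
  differentiable, so its gradient is that of its real-valued version.\<close>

definition Q_model ::
  "(real^'n \<Rightarrow> ereal) \<Rightarrow> (real^'m \<Rightarrow> ereal) \<Rightarrow> real^'n^'m \<Rightarrow> real \<Rightarrow> real^'m \<Rightarrow> real^'m \<Rightarrow> ereal" where
  "Q_model f g A L y w =
     dual_F f A w
     + ereal ((y - w) \<bullet> gradient (\<lambda>v. real_of_ereal (dual_F f A v)) w)
     + ereal (L / 2 * (norm (y - w))\<^sup>2)
     + dual_G g y"

definition p_step ::
  "(real^'n \<Rightarrow> ereal) \<Rightarrow> (real^'m \<Rightarrow> ereal) \<Rightarrow> real^'n^'m \<Rightarrow> real \<Rightarrow> real^'m \<Rightarrow> real^'m" where
  "p_step f g A L w = arg_min (\<lambda>y. Q_model f g A L y w) (\<lambda>_. True)"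

definition majorizes ::
  "(real^'n \<Rightarrow> ereal) \<Rightarrow> (real^'m \<Rightarrow> ereal) \<Rightarrow> real^'n^'m \<Rightarrow> real \<Rightarrow> real^'m \<Rightarrow> bool" where
  "majorizes f g A L w \<longleftrightarrow>
     neg_dual_q f g A (p_step f g A L w) \<le> Q_model f g A L (p_step f g A L w) w"

definition T_sum :: "(nat \<Rightarrow> real) \<Rightarrow> nat \<Rightarrow> real" where
  "T_sum t k = (\<Sum>i\<le>k. t i)"

text \<open>\<open>gfdpg f g A L t y w\<close> states that \<open>y\<close> and \<open>w\<close> are iterates of the GFDPG method with
  backtracking, run with the admissible choices \<open>L\<close> and \<open>t\<close>.\<close>

definition gfdpg ::
  "(real^'n \<Rightarrow> ereal) \<Rightarrow> (real^'m \<Rightarrow> ereal) \<Rightarrow> real^'n^'m \<Rightarrow> (nat \<Rightarrow> real) \<Rightarrow> (nat \<Rightarrow> real)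
     \<Rightarrow> (nat \<Rightarrow> real^'m) \<Rightarrow> (nat \<Rightarrow> real^'m) \<Rightarrow> bool" where
  "gfdpg f g A L t y w \<longleftrightarrow>
     0 < L 0 \<and> w 0 = y 0 \<and> 0 < t 0 \<and> t 0 \<le> 1 \<and>
     (\<forall>k\<ge>1.
        L (k - 1) \<le> L k \<and>
        majorizes f g A (L k) (w (k - 1)) \<and>
        y k = p_step f g A (L k) (w (k - 1)) \<and>
        0 < t k \<and> (t k)\<^sup>2 \<le> T_sum t k \<and>
        w k = y k
          + (((T_sum t (k - 1) - t (k - 1)) * t k) / (t (k - 1) * T_sum t k)) *\<^sub>R (y k - y (k - 1))
          + ((((t (k - 1))\<^sup>2 - T_sum t (k - 1)) * t k) / (t (k - 1) * T_sum t k))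
              *\<^sub>R (y k - w (k - 1)))"

end

theory Submission
  imports Defs
begin

text \<open>Convexity of \<open>F\<close>, the backtracking condition and the \<open>L\<close>-strong convexity of \<open>Q\<^sub>L(\<cdot>, w)\<close> give, for
  \<open>p = p\<^sub>L(w)\<close> and every \<open>x\<close>, the inequality \<open>q'(p) + L/2 \<parallel>x - p\<parallel>\<^sup>2 \<le> q'(x) + L/2 \<parallel>x - w\<parallel>\<^sup>2\<close> with \<open>q' = F + G\<close>.
  Adding its instances \<open>x = y\<^sub>*\<close> (weight \<open>t\<^sub>k\<close>) and \<open>x = y\<^sub>k\<close> (weight \<open>T\<^sub>k - t\<^sub>k\<close>) shows that
  \<open>2/L\<^sub>k (T\<^sub>k - t\<^sub>k) (q'(y\<^sub>k) - q'(y\<^sub>*)) + \<parallel>u\<^sub>k - y\<^sub>*\<parallel>\<^sup>2 + (\<Sum>i<k. (T\<^sub>i - t\<^sub>i\<^sup>2) \<parallel>y\<^sub>i\<^sub>+\<^sub>1 - w\<^sub>i\<parallel>\<^sup>2)\<close>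
  is nonincreasing in \<open>k\<close>, where \<open>u\<^sub>k = (T\<^sub>k w\<^sub>k - (T\<^sub>k - t\<^sub>k) y\<^sub>k) / t\<^sub>k\<close> and \<open>u\<^sub>0 = y\<^sub>0\<close>. Both rates follow, the
  second one after one more proximal step from \<open>y\<^sub>k\<close>.

  Existence of the minimizers, smoothness of \<open>f\<^sup>*\<close> and properness of \<open>g\<^sup>*\<close> all come from one fact: a
  proper closed strongly convex function has a minimizer, around which it grows quadratically.\<close>

section \<open>Closed extended-valued functions and attained infima\<close>

lemma closed_ext_sublevel:
  assumes "ext_closed h"
  shows "closed {x. h x \<le> ereal r}"
proof -
  have "closed ((\<lambda>x. (x, r)) -` ext_epigraph h)"
    using assms unfolding ext_closed_def
    by (intro closed_vimage continuous_intros)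
  then show ?thesis by (simp add: ext_epigraph_def vimage_def)
qed

text \<open>The sublevel sets at levels reached on \<open>K\<close> are closed and nested, so by
  compactness they share a point of \<open>K\<close>, and such a point is a minimizer. If
  \<open>h\<close> is \<infinity> throughout \<open>K\<close>, there are no such levels and any
  point serves.\<close>

lemma ext_closed_attains_inf:
  fixes h :: "'a::t2_space \<Rightarrow> ereal"
  assumes "ext_closed h" and "compact K" and "K \<noteq> {}"
  shows "\<exists>x\<in>K. \<forall>z\<in>K. h x \<le> h z"
proof -
  define S where "S = (\<lambda>r. {x. h x \<le> ereal r})"
  define R where "R = {r. \<exists>z\<in>K. h z \<le> ereal r}"
  have "K \<inter> \<Inter> (S ` R) \<noteq> {}"
  proof (rule compact_imp_fip[OF assms(2)])
    show "\<And>T. T \<in> S ` R \<Longrightarrow> closed T"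
      using closed_ext_sublevel[OF assms(1)] by (auto simp: S_def)
  next
    fix \<F> assume fin: "finite \<F>" and sub: "\<F> \<subseteq> S ` R"
    then obtain B where B: "finite B" "B \<subseteq> R" "\<F> = S ` B"
      by (meson finite_subset_image)
    show "K \<inter> \<Inter> \<F> \<noteq> {}"
    proof (cases "B = {}")
      case True
      then show ?thesis using B assms(3) by simp
    next
      case False
      then have "Min B \<in> R" using B Min_in by blast
      then obtain z where z: "z \<in> K" "h z \<le> ereal (Min B)" by (auto simp: R_def)
      have "h z \<le> ereal b" if "b \<in> B" for b
        using z(2) that B(1) by (meson Min_le ereal_less_eq(3) order_trans)
      then show ?thesis using z B(3) by (auto simp: S_def)
    qed
  qed
  then obtain x where x: "x \<in> K" "\<And>r. r \<in> R \<Longrightarrow> h x \<le> ereal r" by (auto simp: S_def)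
  have "h x \<le> h z" if "z \<in> K" for z
  proof (rule ereal_le_real)
    show "h x \<le> ereal r" if "h z \<le> ereal r" for r
      using x(2) that \<open>z \<in> K\<close> by (auto simp: R_def)
  qed
  then show ?thesis using x(1) by blast
qed

section \<open>Strong convexity: existence of minimizers and quadratic growth\<close>

lemma ext_strongly_convexD_real:
  assumes "ext_strongly_convex \<sigma> h" and "0 < \<theta>" and "\<theta> < 1"
    and "h x = ereal a" and "h y = ereal b"
  shows "h (\<theta> *\<^sub>R x + (1 - \<theta>) *\<^sub>R y)
           \<le> ereal (\<theta> * a + (1 - \<theta>) * b - \<sigma> / 2 * \<theta> * (1 - \<theta>) * (norm (x - y))\<^sup>2)"
  using assms unfolding ext_strongly_convex_def by (metis greaterThanLessThan_iff ereal_minus(1) plus_ereal.simps(1) times_ereal.simps(1))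

text \<open>The work lies in coercivity. On the segment from \<open>x0\<close> to a point of
  \<open>S\<close> at distance \<open>s > 1\<close>, strong convexity makes the value at distance 1
  at most \<open>c - \<sigma>/2 * (s - 1)\<close>, whereas the minimum \<open>m\<close> over the
  unit ball bounds it from below. So \<open>S\<close> is bounded, hence compact.\<close>

lemma ext_strongly_convex_has_min:
  fixes h :: "'a::euclidean_space \<Rightarrow> ereal"
  assumes proper: "ext_proper h" and cl: "ext_closed h"
    and \<sigma>: "0 < \<sigma>" and sc: "ext_strongly_convex \<sigma> h"
  shows "\<exists>x. \<forall>z. h x \<le> h z"
proof -
  obtain x0 c where c: "h x0 = ereal c"
    using proper unfolding ext_proper_def by (metis ereal_cases)
  obtain v where v: "\<forall>z\<in>cball x0 1. h v \<le> h z"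
    using ext_closed_attains_inf[OF cl compact_cball, of x0 1] by auto
  then have "h v \<le> ereal c" using c by (metis centre_in_cball zero_le_one)
  moreover have "h v \<noteq> -\<infinity>" using proper by (simp add: ext_proper_def)
  ultimately obtain m where m: "h v = ereal m" by (cases "h v") auto
  have mc: "m \<le> c" using \<open>h v \<le> ereal c\<close> m by simp
  define S where "S = {x. h x \<le> ereal c}"
  have bound: "dist x0 x \<le> 1 + 2 * (c - m) / \<sigma>" if "x \<in> S" for x
  proof (cases "dist x0 x \<le> 1")
    case True
    then show ?thesis using mc \<sigma> by (smt (verit) divide_nonneg_pos)
  next
    case False
    define s where "s = norm (x - x0)"
    have s: "s > 1" using False by (simp add: s_def dist_norm norm_minus_commute)
    have "h x \<noteq> -\<infinity>" using proper by (simp add: ext_proper_def)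
    then obtain a where a: "h x = ereal a" "a \<le> c" using \<open>x \<in> S\<close> by (cases "h x") (auto simp: S_def)
    \<comment> \<open>The weight \<open>1/s\<close> places \<open>?z\<close> on the unit sphere
      around \<open>x0\<close>.\<close>
    let ?z = "(1/s) *\<^sub>R x + (1 - 1/s) *\<^sub>R x0"
    have "x0 - ?z = (1/s) *\<^sub>R (x0 - x)" by (simp add: algebra_simps)
    moreover have "norm (x0 - x) = s" by (simp add: s_def norm_minus_commute)
    ultimately have "norm (x0 - ?z) = 1" using s by simp
    then have "dist x0 ?z = 1" by (simp add: dist_norm)
    then have "ereal m \<le> h ?z" using v m by (metis mem_cball order_refl)
    also have "\<dots> \<le> ereal ((1/s) * a + (1 - 1/s) * c - \<sigma>/2 * (1/s) * (1 - 1/s) * (norm (x - x0))\<^sup>2)"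
      using s by (intro ext_strongly_convexD_real[OF sc _ _ a(1) c]) auto
    finally have "m \<le> (1/s) * a + (1 - 1/s) * c - \<sigma>/2 * (1/s) * (1 - 1/s) * s\<^sup>2"
      by (simp add: s_def)
    also have "\<sigma>/2 * (1/s) * (1 - 1/s) * s\<^sup>2 = \<sigma>/2 * (s - 1)"
      using s by (simp add: field_simps power2_eq_square)
    finally have "m \<le> (1/s) * a + (1 - 1/s) * c - \<sigma>/2 * (s - 1)" .
    moreover have "(1/s) * a \<le> (1/s) * c" using a(2) s by (intro mult_left_mono) auto
    moreover have "(1/s) * c + (1 - 1/s) * c = c" by (simp add: algebra_simps)
    ultimately have "m \<le> c - \<sigma>/2 * (s - 1)" by linarith
    then have "s \<le> 1 + 2 * (c - m) / \<sigma>" using \<sigma> by (simp add: field_simps)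
    then show ?thesis by (simp add: s_def dist_norm norm_minus_commute)
  qed
  have "bounded S" unfolding bounded_def using bound by blast
  moreover have "closed S" unfolding S_def by (rule closed_ext_sublevel[OF cl])
  ultimately have "compact S" by (simp add: compact_eq_bounded_closed)
  moreover have "x0 \<in> S" using c by (simp add: S_def)
  ultimately obtain x where "x \<in> S" "\<forall>z\<in>S. h x \<le> h z"
    using ext_closed_attains_inf[OF cl, of S] by auto
  then have "h x \<le> h z" for z by (cases "z \<in> S") (auto simp: S_def)
  then show ?thesis by blast
qed

lemma ext_proper_min_finite:
  assumes "ext_proper h" and "\<And>z. h x \<le> h z"
  shows "\<exists>a. h x = ereal a"
  using assms unfolding ext_proper_def by (metis ereal_cases ereal_infty_less_eq(1))

text \<open>Compare \<open>h x\<close> with the value at the point of the segment that has weight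
  \<open>\<theta>\<close> on \<open>z\<close>, divide by \<open>\<theta>\<close>, and let \<theta>
  tend to 0 to recover the full constant.\<close>

lemma ext_strongly_convex_quadratic_growth:
  fixes h :: "'a::real_normed_vector \<Rightarrow> ereal"
  assumes proper: "ext_proper h" and sc: "ext_strongly_convex \<sigma> h"
    and min: "\<And>z. h x \<le> h z"
  shows "h x + ereal (\<sigma> / 2 * (norm (z - x))\<^sup>2) \<le> h z"
proof -
  obtain a where a: "h x = ereal a" using ext_proper_min_finite[OF proper min] by blast
  show ?thesis
  proof (cases "h z")
    case (real b)
    define d where "d = \<sigma> / 2 * (norm (z - x))\<^sup>2"
    have "a + (1 - \<theta>) * d \<le> b" if "0 < \<theta>" "\<theta> < 1" for \<theta>
    proof -
      have "ereal a \<le> ereal (\<theta> * b + (1 - \<theta>) * a - \<sigma> / 2 * \<theta> * (1 - \<theta>) * (norm (z - x))\<^sup>2)"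
        using min ext_strongly_convexD_real[OF sc that real a] a by (metis order_trans)
      then have "\<theta> * (a + (1 - \<theta>) * d) \<le> \<theta> * b" by (simp add: d_def algebra_simps)
      then show ?thesis using that by simp
    qed
    then have "\<forall>\<^sub>F \<theta> in at_right 0. a + (1 - \<theta>) * d \<le> b"
      unfolding eventually_at_right_field by (intro exI[of _ 1]) auto
    moreover have "((\<lambda>\<theta>. a + (1 - \<theta>) * d) \<longlongrightarrow> a + (1 - 0) * d) (at_right 0)"
      by (intro tendsto_intros)
    ultimately have "a + (1 - 0) * d \<le> b"
      using tendsto_upperbound trivial_limit_at_right_real by blast
    then show ?thesis using a real by (simp add: d_def)
  qed (use a min[of z] in auto)
qed

section \<open>Stability under quadratic perturbations\<close>

text \<open>Casting convexity as modulus 0 lets \<open>ext_convex_prox\<close> serve both the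
  strongly convex \<open>f\<close> and the merely convex \<open>g\<close> and
  \<open>dual_G g\<close>.\<close>

lemma ext_convex_imp_strongly_convex_0:
  fixes h :: "'a::real_normed_vector \<Rightarrow> ereal"
  assumes cv: "ext_convex h" and bot: "\<And>x. h x \<noteq> -\<infinity>"
  shows "ext_strongly_convex 0 h"
  unfolding ext_strongly_convex_def
proof (intro allI ballI)
  fix x y :: 'a and \<theta> :: real assume \<theta>: "\<theta> \<in> {0<..<1}"
  have "h (\<theta> *\<^sub>R x + (1 - \<theta>) *\<^sub>R y) \<le> ereal \<theta> * h x + ereal (1 - \<theta>) * h y"
  proof (cases "h x = \<infinity> \<or> h y = \<infinity>")
    case True
    then show ?thesis using \<theta> bot[of x] bot[of y] by (cases "h x"; cases "h y") auto
  next
    case False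
    then obtain a b where ab: "h x = ereal a" "h y = ereal b" using bot by (metis ereal_cases)
    then have "(x, a) \<in> ext_epigraph h" "(y, b) \<in> ext_epigraph h" by (auto simp: ext_epigraph_def)
    then have "\<theta> *\<^sub>R (x, a) + (1 - \<theta>) *\<^sub>R (y, b) \<in> ext_epigraph h"
      using cv \<theta> unfolding ext_convex_def by (intro convexD) auto
    then show ?thesis using ab by (simp add: ext_epigraph_def)
  qed
  then show "h (\<theta> *\<^sub>R x + (1 - \<theta>) *\<^sub>R y) \<le> ereal \<theta> * h x + ereal (1 - \<theta>) * h y
      - ereal (0 / 2 * \<theta> * (1 - \<theta>) * (norm (x - y))\<^sup>2)" by simp
qed

text \<open>Along a segment the quadratic satisfies the strong convexity inequality with equality,
  so its modulus adds to that of \<open>h\<close>.\<close>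

lemma ext_strongly_convex_add_quadratic:
  fixes h :: "'a::real_inner \<Rightarrow> ereal"
  assumes sc: "ext_strongly_convex \<sigma> h" and bot: "\<And>x. h x \<noteq> -\<infinity>"
  shows "ext_strongly_convex (\<sigma> + c) (\<lambda>x. h x + ereal (a + b \<bullet> x + c / 2 * (norm (x - v))\<^sup>2))"
    (is "ext_strongly_convex _ (\<lambda>x. h x + ereal (?r x))")
  unfolding ext_strongly_convex_def
proof (intro allI ballI)
  fix x y :: 'a and \<theta> :: real assume \<theta>: "\<theta> \<in> {0<..<1}"
  let ?z = "\<theta> *\<^sub>R x + (1 - \<theta>) *\<^sub>R y"
  show "h ?z + ereal (?r ?z) \<le> ereal \<theta> * (h x + ereal (?r x)) + ereal (1 - \<theta>) * (h y + ereal (?r y))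
      - ereal ((\<sigma> + c) / 2 * \<theta> * (1 - \<theta>) * (norm (x - y))\<^sup>2)"
  proof (cases "h x = \<infinity> \<or> h y = \<infinity>")
    case True
    then show ?thesis using \<theta> bot[of x] bot[of y] by (cases "h x"; cases "h y") auto
  next
    case False
    then obtain p q where pq: "h x = ereal p" "h y = ereal q" using bot by (metis ereal_cases)
    have "?r ?z = \<theta> * ?r x + (1 - \<theta>) * ?r y - c / 2 * \<theta> * (1 - \<theta>) * (norm (x - y))\<^sup>2"
    proof -
      have z: "?z - v = \<theta> *\<^sub>R (x - v) + (1 - \<theta>) *\<^sub>R (y - v)" by (simp add: algebra_simps)
      have xy: "x - y = (x - v) - (y - v)" by simp
      have n: "(norm (?z - v))\<^sup>2 = \<theta> * (norm (x - v))\<^sup>2 + (1 - \<theta>) * (norm (y - v))\<^sup>2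
          - \<theta> * (1 - \<theta>) * (norm (x - y))\<^sup>2"
        unfolding z xy power2_norm_eq_inner
        by (simp add: inner_diff inner_add algebra_simps inner_commute power2_eq_square)
      have i: "b \<bullet> ?z = \<theta> * (b \<bullet> x) + (1 - \<theta>) * (b \<bullet> y)" by (simp add: inner_add)
      show ?thesis unfolding n i by (simp add: field_simps)
    qed
    moreover have "h ?z \<le> ereal (\<theta> * p + (1 - \<theta>) * q - \<sigma> / 2 * \<theta> * (1 - \<theta>) * (norm (x - y))\<^sup>2)"
      using ext_strongly_convexD_real[OF sc _ _ pq] \<theta> by simp
    ultimately show ?thesis using pq by (cases "h ?z") (auto simp: algebra_simps add_divide_distrib)
  qed
qed

text \<open>The shear sending \<open>(x, s)\<close> to \<open>(x, s - r x)\<close> is continuous and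
  pulls the epigraph of \<open>h\<close> back to that of the sum.\<close>

lemma ext_closed_add_continuous:
  fixes h :: "'a::topological_space \<Rightarrow> ereal"
  assumes "ext_closed h" and "continuous_on UNIV r"
  shows "ext_closed (\<lambda>x. h x + ereal (r x))"
proof -
  have "continuous_on UNIV (\<lambda>p. (fst p, snd p - r (fst p)))"
    by (intro continuous_intros continuous_on_compose2[OF assms(2)]) auto
  then have "closed ((\<lambda>p. (fst p, snd p - r (fst p))) -` ext_epigraph h)"
    using assms(1) unfolding ext_closed_def by (intro closed_vimage)
  also have "(\<lambda>p. (fst p, snd p - r (fst p))) -` ext_epigraph h = ext_epigraph (\<lambda>x. h x + ereal (r x))"
  proof -
    have "h x \<le> ereal (s - r x) \<longleftrightarrow> h x + ereal (r x) \<le> ereal s" for x s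
      by (cases "h x") auto
    then show ?thesis by (auto simp: ext_epigraph_def)
  qed
  finally show ?thesis by (simp add: ext_closed_def)
qed

lemma ext_proper_add_real:
  "ext_proper h \<Longrightarrow> ext_proper (\<lambda>x. h x + ereal (r x))"
  unfolding ext_proper_def by (metis MInfty_neq_ereal(1) PInfty_neq_ereal(1) ereal_plus_eq_MInfty ereal_plus_eq_PInfty)

text \<open>The template for all three minimizations below: \<open>\<sigma> = 0\<close>,
  \<open>c = 1\<close> for properness of a conjugate, \<open>c = 0\<close> for the maximizer in the
  conjugate of a strongly convex function, and \<open>\<sigma> = 0\<close>, \<open>c = L\<close> for
  the proximal step.\<close>

lemma ext_convex_prox:
  fixes h :: "'a::euclidean_space \<Rightarrow> ereal"
  assumes "ext_proper h" and "ext_closed h" and "ext_strongly_convex \<sigma> h" and "0 < \<sigma> + c"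
    and \<phi>_def: "\<phi> = (\<lambda>x. h x + ereal (a + b \<bullet> x + c / 2 * (norm (x - v))\<^sup>2))"
  shows "ext_proper \<phi>" and "ext_strongly_convex (\<sigma> + c) \<phi>" and "\<exists>x. \<forall>z. \<phi> x \<le> \<phi> z"
proof -
  show 1: "ext_proper \<phi>" unfolding \<phi>_def by (rule ext_proper_add_real[OF assms(1)])
  show 2: "ext_strongly_convex (\<sigma> + c) \<phi>"
    unfolding \<phi>_def using assms(1,3)
    by (intro ext_strongly_convex_add_quadratic) (auto simp: ext_proper_def)
  have "ext_closed \<phi>"
    unfolding \<phi>_def by (intro ext_closed_add_continuous[OF assms(2)] continuous_intros)
  from ext_strongly_convex_has_min[OF 1 this assms(4) 2] show "\<exists>x. \<forall>z. \<phi> x \<le> \<phi> z" .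
qed

section \<open>Convex conjugates: properness, closedness, convexity and smoothness\<close>

lemma convex_conjugate_upper:
  "ereal (u \<bullet> x) - h x \<le> convex_conjugate h u"
  unfolding convex_conjugate_def by (rule SUP_upper) simp

lemma convex_conjugate_not_MInf:
  assumes "ext_proper h"
  shows "convex_conjugate h u \<noteq> -\<infinity>"
proof -
  obtain x a where "h x = ereal a" using assms unfolding ext_proper_def by (metis ereal_cases)
  then show ?thesis using convex_conjugate_upper[of u x h] by auto
qed

text \<open>Quadratic growth of \<open>h + \<parallel>\<cdot>\<parallel>\<^sup>2 / 2\<close> around its minimizer \<open>v\<close> is an affine minorant of \<open>h\<close> with
  slope \<open>- v\<close>, so no separation theorem is required.\<close>

lemma convex_conjugate_proper:
  fixes h :: "'a::euclidean_space \<Rightarrow> ereal"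
  assumes "ext_proper h" and "ext_closed h" and "ext_convex h"
  shows "ext_proper (convex_conjugate h)"
proof -
  have sc: "ext_strongly_convex 0 h"
    using assms by (intro ext_convex_imp_strongly_convex_0) (auto simp: ext_proper_def)
  let ?\<phi> = "\<lambda>x. h x + ereal (0 + 0 \<bullet> x + 1 / 2 * (norm (x - 0))\<^sup>2)"
  have prox: "ext_proper ?\<phi>" "ext_strongly_convex (0 + 1) ?\<phi>" "\<exists>x. \<forall>z. ?\<phi> x \<le> ?\<phi> z"
    by (rule ext_convex_prox[OF assms(1,2) sc _ refl], simp)+
  obtain v where v: "\<And>z. ?\<phi> v \<le> ?\<phi> z" using prox(3) by blast
  have growth: "?\<phi> v + ereal ((0 + 1) / 2 * (norm (z - v))\<^sup>2) \<le> ?\<phi> z" for z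
    by (rule ext_strongly_convex_quadratic_growth[OF prox(1,2) v])
  obtain a where "?\<phi> v = ereal a" using ext_proper_min_finite[OF prox(1) v] by blast
  then obtain a where a: "h v = ereal a" by (cases "h v") auto
  have "convex_conjugate h (- v) \<le> ereal (- a - v \<bullet> v)"
    unfolding convex_conjugate_def
  proof (rule SUP_least)
    fix z
    \<comment> \<open>With this expansion the terms in \<open>norm z\<close> cancel, and growth
      around \<open>v\<close> reads
      \<open>a + v \<bullet> v - v \<bullet> z \<le> h z\<close>.\<close>
    have "(norm (z - v))\<^sup>2 = (norm z)\<^sup>2 + v \<bullet> v - 2 * (v \<bullet> z)"
      by (simp add: power2_norm_eq_inner inner_diff inner_commute)
    then show "ereal (- v \<bullet> z) - h z \<le> ereal (- a - v \<bullet> v)"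
      using growth[of z] a by (cases "h z") (auto simp: power2_norm_eq_inner field_simps)
  qed
  then show ?thesis
    unfolding ext_proper_def using convex_conjugate_not_MInf[OF assms(1)] by (metis ereal_infty_less_eq(1) PInfty_neq_ereal(1))
qed

text \<open>The epigraph of a supremum is the intersection of the epigraphs; each \<open>x\<close>
  in the domain of \<open>h\<close> contributes a closed halfspace, every other \<open>x\<close> the
  whole space.\<close>

lemma convex_conjugate_closed:
  assumes "ext_proper h"
  shows "ext_closed (convex_conjugate h)"
proof -
  have "ext_epigraph (convex_conjugate h) = (\<Inter>x. {p. ereal (fst p \<bullet> x) - h x \<le> ereal (snd p)})"
    unfolding ext_epigraph_def convex_conjugate_def by (auto simp: SUP_le_iff)
  moreover have "closed {p::'a \<times> real. ereal (fst p \<bullet> x) - h x \<le> ereal (snd p)}" for x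
  proof (cases "h x")
    case (real a)
    have "closed {p::'a \<times> real. fst p \<bullet> x - a \<le> snd p}"
      by (intro closed_Collect_le continuous_intros)
    then show ?thesis using real by simp
  qed (use assms in \<open>auto simp: ext_proper_def\<close>)
  ultimately show ?thesis unfolding ext_closed_def by auto
qed

lemma convex_conjugate_convex:
  assumes "ext_proper h"
  shows "ext_convex (convex_conjugate h)"
proof -
  have "ext_epigraph (convex_conjugate h) = (\<Inter>x. {p. ereal (fst p \<bullet> x) - h x \<le> ereal (snd p)})"
    unfolding ext_epigraph_def convex_conjugate_def by (auto simp: SUP_le_iff)
  moreover have "convex {p::'a \<times> real. ereal (fst p \<bullet> x) - h x \<le> ereal (snd p)}" for x
  proof (cases "h x")
    case (real a)
    \<comment> \<open>The epigraph of one affine function is a halfspace with normal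
      \<open>(x, -1)\<close>.\<close>
    have eq: "{p::'a \<times> real. ereal (fst p \<bullet> x) - h x \<le> ereal (snd p)} = {p. (x, -1) \<bullet> p \<le> a}"
      using real by (auto simp: inner_prod_def inner_commute)
    show ?thesis unfolding eq by (rule convex_halfspace_le)
  qed (use assms in \<open>auto simp: ext_proper_def\<close>)
  ultimately show ?thesis unfolding ext_convex_def by (auto intro: convex_INT)
qed

text \<open>Expand the square of \<open>p - \<sigma> *\<^sub>R q\<close>. The weights are those for
  which the last term cancels quadratic growth of modulus \<open>\<sigma>\<close>.\<close>

lemma young_inner:
  fixes p q :: "'a::real_inner"
  assumes "0 < \<sigma>"
  shows "p \<bullet> q \<le> (norm p)\<^sup>2 / (2 * \<sigma>) + \<sigma> / 2 * (norm q)\<^sup>2"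
proof -
  have "0 \<le> (p - \<sigma> *\<^sub>R q) \<bullet> (p - \<sigma> *\<^sub>R q)" by simp
  also have "\<dots> = (norm p)\<^sup>2 - 2 * \<sigma> * (p \<bullet> q) + \<sigma>\<^sup>2 * (norm q)\<^sup>2"
    unfolding power2_norm_eq_inner
    by (simp add: inner_diff inner_commute power2_eq_square algebra_simps)
  finally have "2 * \<sigma> * (p \<bullet> q) \<le> (norm p)\<^sup>2 + \<sigma>\<^sup>2 * (norm q)\<^sup>2" by simp
  then have "p \<bullet> q \<le> ((norm p)\<^sup>2 + \<sigma>\<^sup>2 * (norm q)\<^sup>2) / (2 * \<sigma>)"
    using assms by (simp add: field_simps)
  also have "\<dots> = (norm p)\<^sup>2 / (2 * \<sigma>) + \<sigma> / 2 * (norm q)\<^sup>2"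
    using assms by (simp add: field_simps power2_eq_square)
  finally show ?thesis .
qed

text \<open>Here \<open>x\<close> is the maximizer in the conjugate at \<open>u\<close>. As a
  competitor at \<open>v\<close> it gives the affine lower bound; quadratic growth around it and
  Young's inequality give the upper one. Together they make \<open>x\<close> the gradient of the
  conjugate at \<open>u\<close>.\<close>

lemma convex_conjugate_quadratic_bounds:
  fixes h :: "'a::euclidean_space \<Rightarrow> ereal"
  assumes proper: "ext_proper h" and cl: "ext_closed h"
    and \<sigma>: "0 < \<sigma>" and sc: "ext_strongly_convex \<sigma> h"
  obtains x a where "convex_conjugate h u = ereal a"
    and "\<And>v. ereal (a + (v - u) \<bullet> x) \<le> convex_conjugate h v"
    and "\<And>v. convex_conjugate h v \<le> ereal (a + (v - u) \<bullet> x + (norm (v - u))\<^sup>2 / (2 * \<sigma>))"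
proof -
  let ?\<phi> = "\<lambda>x. h x + ereal (0 + (- u) \<bullet> x + 0 / 2 * (norm (x - 0))\<^sup>2)"
  have prox: "ext_proper ?\<phi>" "ext_strongly_convex (\<sigma> + 0) ?\<phi>" "\<exists>x. \<forall>z. ?\<phi> x \<le> ?\<phi> z"
    by (rule ext_convex_prox[OF proper cl sc _ refl], simp add: \<sigma>)+
  obtain x where x: "\<And>z. ?\<phi> x \<le> ?\<phi> z" using prox(3) by blast
  have growth: "?\<phi> x + ereal ((\<sigma> + 0) / 2 * (norm (z - x))\<^sup>2) \<le> ?\<phi> z" for z
    by (rule ext_strongly_convex_quadratic_growth[OF prox(1,2) x])
  obtain r where "?\<phi> x = ereal r" using ext_proper_min_finite[OF prox(1) x] by blast
  then obtain r where r: "h x = ereal r" by (cases "h x") auto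
  define a where "a = u \<bullet> x - r"
  have lower: "ereal (a + (v - u) \<bullet> x) \<le> convex_conjugate h v" for v
    using convex_conjugate_upper[of v x h] r by (simp add: a_def inner_diff)
  have upper: "convex_conjugate h v \<le> ereal (a + (v - u) \<bullet> x + (norm (v - u))\<^sup>2 / (2 * \<sigma>))" for v
    unfolding convex_conjugate_def
  proof (rule SUP_least)
    fix z
    show "ereal (v \<bullet> z) - h z \<le> ereal (a + (v - u) \<bullet> x + (norm (v - u))\<^sup>2 / (2 * \<sigma>))"
    proof (cases "h z")
      case (real s)
      have "r - u \<bullet> x + \<sigma> / 2 * (norm (z - x))\<^sup>2 \<le> s - u \<bullet> z"
        using growth[of z] r real by simp
      then show ?thesis
        using young_inner[OF \<sigma>, of "v - u" "z - x"] real by (simp add: a_def inner_diff)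
    qed (use proper in \<open>auto simp: ext_proper_def\<close>)
  qed
  \<comment> \<open>At \<open>v = u\<close> the two bounds coincide.\<close>
  have "convex_conjugate h u = ereal a"
    using lower[of u] upper[of u] by (simp add: order_antisym)
  with lower upper that show thesis by blast
qed

section \<open>Gradient of \<open>F\<close>, regularity of \<open>G\<close> and the proximal
  step\<close>

lemma GDERIV_quadratic_remainder:
  fixes F :: "'a::real_inner \<Rightarrow> real"
  assumes "\<And>v. \<bar>F v - F w - (v - w) \<bullet> d\<bar> \<le> K * (norm (v - w))\<^sup>2"
  shows "GDERIV F w :> d"
  unfolding gderiv_def has_derivative_at
proof
  show "bounded_linear (\<lambda>h. h \<bullet> d)" by (rule bounded_linear_inner_left)
  have "norm (norm (F (w + h) - F w - h \<bullet> d) / norm h) \<le> K * norm h" for h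
  proof (cases "h = 0")
    case False
    have "\<bar>F (w + h) - F w - h \<bullet> d\<bar> \<le> K * (norm h)\<^sup>2" using assms[of "w + h"] by simp
    then have "\<bar>F (w + h) - F w - h \<bullet> d\<bar> / norm h \<le> K * (norm h)\<^sup>2 / norm h"
      by (rule divide_right_mono) simp
    also have "\<dots> = K * norm h" by (simp add: power2_eq_square)
    finally show ?thesis by simp
  qed simp
  moreover have "((\<lambda>h::'a. K * norm h) \<longlongrightarrow> K * norm (0::'a)) (at 0)" by (intro tendsto_intros)
  then have "((\<lambda>h::'a. K * norm h) \<longlongrightarrow> 0) (at 0)" by simp
  ultimately show "((\<lambda>h. norm (F (w + h) - F w - h \<bullet> d) / norm h) \<longlongrightarrow> 0) (at 0)"
    by (rule Lim_null_comparison[OF always_eventually[OF allI]])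
qed

lemma gradient_eqI:
  assumes "GDERIV F w :> d"
  shows "gradient F w = d"
  unfolding gradient_def
proof (rule the_equality)
  show "GDERIV F w :> d" by (rule assms)
next
  fix e assume "GDERIV F w :> e"
  then have "(\<lambda>h. h \<bullet> e) = (\<lambda>h. h \<bullet> d)"
    using assms unfolding gderiv_def by (rule has_derivative_unique)
  then show "e = d" by (metis inner_commute vector_eq_ldot)
qed

text \<open>The bounds for the conjugate at \<open>transpose A *v w\<close> are pulled back to
  \<open>w\<close>; by adjointness the maximizer \<open>x\<close> turns into the slope
  \<open>A *v x\<close>. Both bounds together identify this slope as the gradient, and the lower one
  is then the gradient inequality.\<close>

lemma dual_F_finite_and_gradient_inequality:
  fixes f :: "real^'n \<Rightarrow> ereal" and A :: "real^'n^'m"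
  assumes "ext_proper f" and "ext_closed f" and "0 < \<sigma>" and "ext_strongly_convex \<sigma> f"
  defines "F \<equiv> \<lambda>v. real_of_ereal (dual_F f A v)"
  shows "dual_F f A v = ereal (F v)"
    and "F w + (v - w) \<bullet> gradient F w \<le> F v"
proof -
  have fin: "dual_F f A v = ereal (F v)" for v
    using convex_conjugate_quadratic_bounds[OF assms(1-4), of "transpose A *v v"]
    unfolding F_def dual_F_def by (metis real_of_ereal.simps(1))
  show "dual_F f A v = ereal (F v)" by (rule fin)
  obtain x a where a: "convex_conjugate f (transpose A *v w) = ereal a"
    and lo: "\<And>v. ereal (a + (v - transpose A *v w) \<bullet> x) \<le> convex_conjugate f v"
    and up: "\<And>v. convex_conjugate f v \<le> ereal (a + (v - transpose A *v w) \<bullet> x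
                + (norm (v - transpose A *v w))\<^sup>2 / (2 * \<sigma>))"
    using convex_conjugate_quadratic_bounds[OF assms(1-4)] by metis
  have diff: "transpose A *v v - transpose A *v w = transpose A *v (v - w)" for v
    by (simp add: matrix_vector_mult_diff_distrib)
  have adj: "(transpose A *v y) \<bullet> x = y \<bullet> (A *v x)" for y
    by (metis dot_lmul_matrix transpose_matrix_vector transpose_transpose)
  have Fw: "F w = a" using a by (simp add: F_def dual_F_def)
  have lower: "F w + (v - w) \<bullet> (A *v x) \<le> F v" for v
    using lo[of "transpose A *v v"] fin[of v] Fw unfolding dual_F_def diff adj by simp
  have upper: "F v \<le> F w + (v - w) \<bullet> (A *v x) + (norm (transpose A *v (v - w)))\<^sup>2 / (2 * \<sigma>)" for v
    using up[of "transpose A *v v"] fin[of v] Fw unfolding dual_F_def diff adj by simp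
  \<comment> \<open>An operator norm bound makes the remainder quadratic in \<open>v - w\<close>,
    with constant \<open>B\<^sup>2 / (2 * \<sigma>)\<close>.\<close>
  obtain B where B: "\<And>y. norm (transpose A *v y) \<le> norm y * B"
    using bounded_linear.bounded[OF matrix_vector_mul_bounded_linear] by blast
  have "\<bar>F v - F w - (v - w) \<bullet> (A *v x)\<bar> \<le> B\<^sup>2 / (2 * \<sigma>) * (norm (v - w))\<^sup>2" for v
  proof -
    have "(norm (transpose A *v (v - w)))\<^sup>2 \<le> (norm (v - w) * B)\<^sup>2"
      by (intro power_mono B) simp
    then have "(norm (transpose A *v (v - w)))\<^sup>2 / (2 * \<sigma>) \<le> (norm (v - w) * B)\<^sup>2 / (2 * \<sigma>)"
      using assms(3) by (intro divide_right_mono) auto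
    then show ?thesis using lower[of v] upper[of v] by (simp add: power_mult_distrib mult.commute)
  qed
  then have "gradient F w = A *v x" by (intro gradient_eqI GDERIV_quadratic_remainder)
  then show "F w + (v - w) \<bullet> gradient F w \<le> F v" using lower by simp
qed

text \<open>Everything is inherited from the conjugate of \<open>g\<close>, since reflection acts
  linearly on epigraphs.\<close>

lemma dual_G_regular:
  fixes g :: "real^'m \<Rightarrow> ereal"
  assumes "ext_proper g" and "ext_closed g" and "ext_convex g"
  shows "ext_proper (dual_G g)" and "ext_closed (dual_G g)" and "ext_strongly_convex 0 (dual_G g)"
proof -
  have epi: "ext_epigraph (dual_G g) = (\<lambda>p. (- fst p, snd p)) -` ext_epigraph (convex_conjugate g)"
    by (auto simp: ext_epigraph_def dual_G_def)
  show pr: "ext_proper (dual_G g)"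
    using convex_conjugate_proper[OF assms] unfolding ext_proper_def dual_G_def
    by (metis minus_minus)
  show "ext_closed (dual_G g)"
    using convex_conjugate_closed[OF assms(1)] unfolding ext_closed_def epi
    by (intro closed_vimage continuous_intros)
  have "linear (\<lambda>p::(real^'m) \<times> real. (- fst p, snd p))" by (intro linearI) auto
  then have "ext_convex (dual_G g)"
    using convex_conjugate_convex[OF assms(1)] unfolding ext_convex_def epi
    by (intro convex_linear_vimage)
  then show "ext_strongly_convex 0 (dual_G g)"
    using pr by (intro ext_convex_imp_strongly_convex_0) (auto simp: ext_proper_def)
qed

text \<open>In \<open>y\<close> the model is \<open>dual_G g\<close> plus an affine term plus a
  quadratic of modulus \<open>L\<close>. Finiteness of \<open>dual_G g\<close> at \<open>p\<close>
  later confines the iterates to the set where the dual function is real.\<close>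

lemma p_step_minimizes:
  fixes f :: "real^'n \<Rightarrow> ereal" and g :: "real^'m \<Rightarrow> ereal" and A :: "real^'n^'m" and w :: "real^'m"
  assumes "ext_proper f" and "ext_closed f" and "0 < \<sigma>" and "ext_strongly_convex \<sigma> f"
    and "ext_proper g" and "ext_closed g" and "ext_convex g" and L: "0 < L"
  defines "p \<equiv> p_step f g A L w"
  shows "Q_model f g A L p w + ereal (L / 2 * (norm (x - p))\<^sup>2) \<le> Q_model f g A L x w"
    and "\<exists>a. dual_G g p = ereal a"
proof -
  define F where "F v = real_of_ereal (dual_F f A v)" for v
  note Ffin = dual_F_finite_and_gradient_inequality(1)[OF assms(1-4), of A, folded F_def]
  note G = dual_G_regular[OF assms(5-7)]
  define d where "d = gradient F w"
  \<comment> \<open>Regrouped to match \<open>ext_convex_prox\<close>, with slope \<open>d\<close>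
    and constant \<open>F w - w \<bullet> d\<close>.\<close>
  have Q: "Q_model f g A L y w = dual_G g y + ereal (F w - w \<bullet> d + d \<bullet> y + L / 2 * (norm (y - w))\<^sup>2)" for y
    unfolding Q_model_def F_def[symmetric] d_def[symmetric] unfolding Ffin
    by (cases "dual_G g y") (auto simp: inner_diff inner_commute)
  have prox: "ext_proper (\<lambda>y. Q_model f g A L y w)"
    "ext_strongly_convex (0 + L) (\<lambda>y. Q_model f g A L y w)"
    "\<exists>x. \<forall>z. Q_model f g A L x w \<le> Q_model f g A L z w"
    unfolding Q by (rule ext_convex_prox[OF G _ refl], simp add: L)+
  have p: "Q_model f g A L p w \<le> Q_model f g A L z w" for z
  proof -
    \<comment> \<open>\<open>arg_min\<close> is a choice, so it is informative only once some
      minimizer is known to exist.\<close>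
    obtain m where "is_arg_min (\<lambda>y. Q_model f g A L y w) (\<lambda>_. True) m"
      using prox(3) by (auto simp: is_arg_min_linorder)
    then have "is_arg_min (\<lambda>y. Q_model f g A L y w) (\<lambda>_. True) p"
      unfolding p_def p_step_def arg_min_def by (rule someI)
    then show ?thesis by (simp add: is_arg_min_linorder)
  qed
  show "Q_model f g A L p w + ereal (L / 2 * (norm (x - p))\<^sup>2) \<le> Q_model f g A L x w"
    using ext_strongly_convex_quadratic_growth[OF prox(1,2) p] by simp
  show "\<exists>a. dual_G g p = ereal a"
    using ext_proper_min_finite[OF prox(1) p] unfolding Q by (cases "dual_G g p") auto
qed

lemma proximal_gradient_inequality:
  fixes f :: "real^'n \<Rightarrow> ereal" and g :: "real^'m \<Rightarrow> ereal" and A :: "real^'n^'m" and w :: "real^'m"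
  assumes "ext_proper f" and "ext_closed f" and "0 < \<sigma>" and "ext_strongly_convex \<sigma> f"
    and "ext_proper g" and "ext_closed g" and "ext_convex g" and L: "0 < L"
    and maj: "majorizes f g A L w"
  defines "p \<equiv> p_step f g A L w"
  shows "neg_dual_q f g A p + ereal (L / 2 * (norm (x - p))\<^sup>2)
           \<le> neg_dual_q f g A x + ereal (L / 2 * (norm (x - w))\<^sup>2)"
proof -
  define F where "F v = real_of_ereal (dual_F f A v)" for v
  note Ffin = dual_F_finite_and_gradient_inequality(1)[OF assms(1-4), of A, folded F_def]
  note Fgrad = dual_F_finite_and_gradient_inequality(2)[OF assms(1-4), of A, folded F_def]
  have "neg_dual_q f g A p + ereal (L / 2 * (norm (x - p))\<^sup>2)
      \<le> Q_model f g A L p w + ereal (L / 2 * (norm (x - p))\<^sup>2)"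
    using maj by (intro add_right_mono) (simp add: majorizes_def p_def)
  also have "\<dots> \<le> Q_model f g A L x w"
    using p_step_minimizes(1)[OF assms(1-8)] by (simp add: p_def)
  \<comment> \<open>The linearization of \<open>F\<close> at \<open>w\<close> lies below
    \<open>F\<close>.\<close>
  also have "\<dots> \<le> neg_dual_q f g A x + ereal (L / 2 * (norm (x - w))\<^sup>2)"
    using Fgrad[of w x] unfolding Q_model_def neg_dual_q_def dual_q_def F_def[symmetric] unfolding Ffin
    by (cases "dual_G g x") auto
  finally show ?thesis .
qed

section \<open>The Lyapunov argument in an inner product space\<close>

text \<open>Expanding around \<open>w\<close> makes the bound affine in \<open>x\<close>, so that
  instances for different \<open>x\<close> can be combined with weights.\<close>

lemma prox_step_inner_form:
  fixes x p w :: "'a::real_inner"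
  assumes "P + L / 2 * (norm (x - p))\<^sup>2 \<le> X + L / 2 * (norm (x - w))\<^sup>2"
  shows "P - X \<le> - (L / 2) * ((norm (p - w))\<^sup>2 + 2 * ((w - x) \<bullet> (p - w)))"
proof -
  have "(norm (x - p))\<^sup>2 - (norm (x - w))\<^sup>2 = (norm (p - w))\<^sup>2 + 2 * ((w - x) \<bullet> (p - w))"
    by (simp add: power2_norm_eq_inner inner_diff inner_commute)
  moreover have "P - X \<le> - (L / 2) * ((norm (x - p))\<^sup>2 - (norm (x - w))\<^sup>2)"
    using assms by (simp add: algebra_simps)
  ultimately show ?thesis by simp
qed

text \<open>The Lyapunov argument works with \<open>u k\<close>, defined by
  \<open>t k *\<^sub>R u k = T_sum t k *\<^sub>R w k - (T_sum t k - t k) *\<^sub>R y k\<close>; the update of \<open>w\<close> is designed precisely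
  so that \<open>u (Suc k) = u k + t k *\<^sub>R (y (Suc k) - w k)\<close>.\<close>

lemma gfdpg_momentum_step:
  fixes y y' w w' :: "'a::real_vector" and t t' T T' :: real
  assumes "0 < t" and "0 < t'" and "T' = T + t'" and "0 < T'"
    and "w' = y' + (((T - t) * t') / (t * T')) *\<^sub>R (y' - y) + (((t\<^sup>2 - T) * t') / (t * T')) *\<^sub>R (y' - w)"
  shows "(1 / t') *\<^sub>R (T' *\<^sub>R w' - (T' - t') *\<^sub>R y')
       = (1 / t) *\<^sub>R (T *\<^sub>R w - (T - t) *\<^sub>R y) + t *\<^sub>R (y' - w)"
proof -
  \<comment> \<open>Applied with \<open>T - t\<close> and \<open>t\<^sup>2 - T\<close> for
    \<open>c\<close>: multiplication by \<open>T'\<close> cancels that factor in both momentum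
    coefficients.\<close>
  have c: "T' * ((c * t') / (t * T')) = t' * (c / t)" for c
    using assms(4) by (simp add: field_simps)
  have "T' *\<^sub>R w' - (T' - t') *\<^sub>R y'
      = t' *\<^sub>R (y' + ((T - t) / t) *\<^sub>R (y' - y) + ((t\<^sup>2 - T) / t) *\<^sub>R (y' - w))"
    unfolding assms(5) scaleR_add_right scaleR_scaleR c
    by (simp add: scaleR_left_diff_distrib)
  then have "(1 / t') *\<^sub>R (T' *\<^sub>R w' - (T' - t') *\<^sub>R y')
      = y' + ((T - t) / t) *\<^sub>R (y' - y) + ((t\<^sup>2 - T) / t) *\<^sub>R (y' - w)"
    using assms(2) by simp
  also have "\<dots> = (1 / t) *\<^sub>R (T *\<^sub>R w - (T - t) *\<^sub>R y) + t *\<^sub>R (y' - w)"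
  proof -
    have 1: "(T - t) / t = T / t - 1" "(t\<^sup>2 - T) / t = t - T / t" "1 / t * (T - t) = T / t - 1"
      using assms(1) by (auto simp: field_simps power2_eq_square)
    show ?thesis unfolding 1 scaleR_diff_right scaleR_scaleR
      by (simp add: 1 algebra_simps)
  qed
  finally show ?thesis .
qed

lemma gfdpg_lyapunov_step:
  fixes x y y' w u u' :: "'a::real_inner" and t T L \<delta> \<delta>' :: real
  assumes t: "0 < t" and tT: "t \<le> T" and L: "0 < L"
    and u: "t *\<^sub>R u = T *\<^sub>R w - (T - t) *\<^sub>R y" and u': "u' = u + t *\<^sub>R (y' - w)"
    and opt: "\<delta>' \<le> - (L / 2) * ((norm (y' - w))\<^sup>2 + 2 * ((w - x) \<bullet> (y' - w)))"
    and prev: "T = t \<or> \<delta>' - \<delta> \<le> - (L / 2) * ((norm (y' - w))\<^sup>2 + 2 * ((w - y) \<bullet> (y' - w)))"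
  shows "2 / L * T * \<delta>' + (norm (u' - x))\<^sup>2 + (T - t\<^sup>2) * (norm (y' - w))\<^sup>2
       \<le> 2 / L * (T - t) * \<delta> + (norm (u - x))\<^sup>2"
proof -
  define e where "e = y' - w"
  have a: "t * \<delta>' \<le> t * (- (L / 2) * ((norm e)\<^sup>2 + 2 * ((w - x) \<bullet> e)))"
    using opt t by (intro mult_left_mono) (auto simp: e_def)
  have b: "(T - t) * (\<delta>' - \<delta>) \<le> (T - t) * (- (L / 2) * ((norm e)\<^sup>2 + 2 * ((w - y) \<bullet> e)))"
    using prev tT unfolding e_def by (elim disjE) (simp, intro mult_left_mono, auto)
  have c: "t * ((w - x) \<bullet> e) + (T - t) * ((w - y) \<bullet> e) = t * ((u - x) \<bullet> e)"
  proof -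
    have "t *\<^sub>R (w - x) + (T - t) *\<^sub>R (w - y) = t *\<^sub>R (u - x)"
      using u by (simp add: algebra_simps)
    then show ?thesis by (metis inner_add_left inner_scaleR_left)
  qed
  \<comment> \<open>The cross term is the one produced by \<open>c\<close>; the last term is what
    lowers the coefficient \<open>T\<close> to \<open>T - t\<^sup>2\<close>.\<close>
  have n: "(norm (u' - x))\<^sup>2 = (norm (u - x))\<^sup>2 + 2 * (t * ((u - x) \<bullet> e)) + t\<^sup>2 * (norm e)\<^sup>2"
  proof -
    have "u' - x = (u - x) + t *\<^sub>R e" using u' by (simp add: e_def)
    then show ?thesis
      unfolding power2_norm_eq_inner
      by (simp only:) (simp add: inner_add inner_commute power2_eq_square algebra_simps)
  qed
  have ring: "t * (- (L / 2) * (N + 2 * \<alpha>)) + (T - t) * (- (L / 2) * (N + 2 * \<beta>))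
      = - (L / 2) * (T * N + 2 * (t * \<alpha> + (T - t) * \<beta>))" for N \<alpha> \<beta> :: real
    by (simp add: field_simps)
  have "T * \<delta>' - (T - t) * \<delta> = t * \<delta>' + (T - t) * (\<delta>' - \<delta>)"
    by (simp add: algebra_simps)
  also have "\<dots> \<le> - (L / 2) * (T * (norm e)\<^sup>2 + 2 * (t * ((u - x) \<bullet> e)))"
    using add_mono[OF a b] unfolding ring c .
  finally have "2 / L * (T * \<delta>' - (T - t) * \<delta>)
      \<le> 2 / L * (- (L / 2) * (T * (norm e)\<^sup>2 + 2 * (t * ((u - x) \<bullet> e))))"
    using L by (intro mult_left_mono) auto
  also have "2 / L * (- (L / 2) * X) = - X" for X using L by simp
  finally have "2 / L * (T * \<delta>' - (T - t) * \<delta>) \<le> - (T * (norm e)\<^sup>2 + 2 * (t * ((u - x) \<bullet> e)))" .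
  moreover have "2 / L * (T * \<delta>' - (T - t) * \<delta>) = 2 / L * T * \<delta>' - 2 / L * (T - t) * \<delta>"
    by (simp only: right_diff_distrib[of "2 / L" "T * \<delta>'" "(T - t) * \<delta>"] mult.assoc)
  moreover have "(T - t\<^sup>2) * (norm e)\<^sup>2 = T * (norm e)\<^sup>2 - t\<^sup>2 * (norm e)\<^sup>2"
    by (rule left_diff_distrib)
  ultimately show ?thesis using n unfolding e_def[symmetric] by linarith
qed

text \<open>\<open>S\<close> stands for the set where the objective is finite; \<open>y 0\<close>
  may lie outside it. The induction carries the extra term \<open>(norm (u k - x))\<^sup>2\<close>,
  which is dropped at the end.\<close>

lemma gfdpg_lyapunov:
  fixes y w :: "nat \<Rightarrow> 'a::real_inner" and \<phi> :: "'a \<Rightarrow> real"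
  assumes L: "0 < L 0" "\<And>k. L k \<le> L (Suc k)"
    and t: "\<And>k. 0 < t k" and w0: "w 0 = y 0"
    and w: "\<And>k. w (Suc k) = y (Suc k)
        + (((T_sum t k - t k) * t (Suc k)) / (t k * T_sum t (Suc k))) *\<^sub>R (y (Suc k) - y k)
        + ((((t k)\<^sup>2 - T_sum t k) * t (Suc k)) / (t k * T_sum t (Suc k))) *\<^sub>R (y (Suc k) - w k)"
    and step: "\<And>k x. x \<in> S \<Longrightarrow>
        \<phi> (y (Suc k)) + L (Suc k) / 2 * (norm (x - y (Suc k)))\<^sup>2 \<le> \<phi> x + L (Suc k) / 2 * (norm (x - w k))\<^sup>2"
    and S: "\<And>k. y (Suc k) \<in> S" and x: "x \<in> S" "\<And>v. v \<in> S \<Longrightarrow> \<phi> x \<le> \<phi> v"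
  shows "2 / L k * (T_sum t k - t k) * (\<phi> (y k) - \<phi> x)
           + (\<Sum>i<k. (T_sum t i - (t i)\<^sup>2) * (norm (y (Suc i) - w i))\<^sup>2) \<le> (norm (y 0 - x))\<^sup>2"
proof -
  define u where "u = (\<lambda>k. (1 / t k) *\<^sub>R (T_sum t k *\<^sub>R w k - (T_sum t k - t k) *\<^sub>R y k))"
  have T_Suc: "T_sum t (Suc k) = T_sum t k + t (Suc k)" for k by (simp add: T_sum_def)
  have T_pos: "0 < T_sum t k" for k unfolding T_sum_def using t by (intro sum_pos) auto
  have tT: "t k \<le> T_sum t k" for k
    unfolding T_sum_def using t by (intro member_le_sum) (auto simp: less_imp_le)
  have Lpos: "0 < L k" for k by (induction k) (use L in \<open>auto intro: less_le_trans\<close>)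
  have T0: "T_sum t 0 = t 0" by (simp add: T_sum_def)
  have "2 / L k * (T_sum t k - t k) * (\<phi> (y k) - \<phi> x) + (norm (u k - x))\<^sup>2
           + (\<Sum>i<k. (T_sum t i - (t i)\<^sup>2) * (norm (y (Suc i) - w i))\<^sup>2) \<le> (norm (y 0 - x))\<^sup>2"
  proof (induction k)
    case 0
    \<comment> \<open>Since \<open>T_sum t 0 = t 0\<close>, the gap at \<open>y 0\<close> has
      coefficient zero, and \<open>u 0 = w 0 = y 0\<close>.\<close>
    have "t 0 \<noteq> 0" using t[of 0] by simp
    then show ?case by (simp add: T0 u_def w0)
  next
    case (Suc k)
    have u_Suc: "u (Suc k) = u k + t k *\<^sub>R (y (Suc k) - w k)"
      unfolding u_def by (rule gfdpg_momentum_step[OF t t T_Suc T_pos w])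
    have "2 / L (Suc k) * T_sum t k * (\<phi> (y (Suc k)) - \<phi> x) + (norm (u (Suc k) - x))\<^sup>2
          + (T_sum t k - (t k)\<^sup>2) * (norm (y (Suc k) - w k))\<^sup>2
        \<le> 2 / L (Suc k) * (T_sum t k - t k) * (\<phi> (y k) - \<phi> x) + (norm (u k - x))\<^sup>2"
    proof (rule gfdpg_lyapunov_step[OF t tT Lpos _ u_Suc prox_step_inner_form[OF step[OF x(1)]]])
      show "t k *\<^sub>R u k = T_sum t k *\<^sub>R w k - (T_sum t k - t k) *\<^sub>R y k"
        using t[of k] by (simp add: u_def)
      \<comment> \<open>The comparison with \<open>y k\<close> requires \<open>y k \<in> S\<close>,
        which is known only for \<open>k \<noteq> 0\<close>.\<close>
      have "\<phi> (y (Suc k)) - \<phi> (y k)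
          \<le> - (L (Suc k) / 2) * ((norm (y (Suc k) - w k))\<^sup>2 + 2 * ((w k - y k) \<bullet> (y (Suc k) - w k)))"
        if "k \<noteq> 0"
        using that S[of "k - 1"] by (intro prox_step_inner_form step) simp
      then show "T_sum t k = t k \<or> \<phi> (y (Suc k)) - \<phi> x - (\<phi> (y k) - \<phi> x)
          \<le> - (L (Suc k) / 2) * ((norm (y (Suc k) - w k))\<^sup>2 + 2 * ((w k - y k) \<bullet> (y (Suc k) - w k)))"
        by (cases "k = 0") (auto simp: T0)
    qed
    \<comment> \<open>As \<open>L\<close> grows, the factor of the gap shrinks; this helps because
      the gap is nonnegative for \<open>k \<noteq> 0\<close>, and for \<open>k = 0\<close> the
      factor \<open>T_sum t k - t k\<close> vanishes.\<close>
    moreover have "2 / L (Suc k) * (T_sum t k - t k) * (\<phi> (y k) - \<phi> x)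
        \<le> 2 / L k * (T_sum t k - t k) * (\<phi> (y k) - \<phi> x)"
    proof (cases k)
      case (Suc j)
      then have "\<phi> x \<le> \<phi> (y k)" using x(2) S by simp
      then show ?thesis using Lpos[of k] L(2)[of k] tT[of k]
        by (intro mult_right_mono divide_left_mono) auto
    qed (simp add: T0)
    ultimately show ?case using Suc.IH by (simp add: T_Suc)
  qed
  then show ?thesis using zero_le_power2[of "norm (u k - x)"] by linarith
qed

text \<open>Replacing each length by the common lower bound \<open>M\<close> gives
  \<open>M\<^sup>2\<close> times the total weight. \<open>M\<close> will be the minimum of the step
  lengths.\<close>

lemma le_of_weighted_square_sum:
  fixes a b :: "'i \<Rightarrow> real" and c d M R :: real
  assumes a: "\<And>i. i \<in> I \<Longrightarrow> 0 \<le> a i" and c: "0 < c" and M: "0 \<le> M" and R: "0 \<le> R"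
    and b: "\<And>i. i \<in> I \<Longrightarrow> M \<le> b i" and d: "M \<le> d"
    and le: "(\<Sum>i\<in>I. a i * (b i)\<^sup>2) + c * d\<^sup>2 \<le> R\<^sup>2"
  shows "M \<le> R / sqrt ((\<Sum>i\<in>I. a i) + c)"
proof -
  define D where "D = (\<Sum>i\<in>I. a i) + c"
  have D: "0 < D" unfolding D_def using a c by (intro add_nonneg_pos sum_nonneg) auto
  have "(\<Sum>i\<in>I. a i) * M\<^sup>2 \<le> (\<Sum>i\<in>I. a i * (b i)\<^sup>2)"
    unfolding sum_distrib_right using a b M by (intro sum_mono mult_left_mono power_mono) auto
  moreover have "c * M\<^sup>2 \<le> c * d\<^sup>2" using c d M by (intro mult_left_mono power_mono) auto
  ultimately have "D * M\<^sup>2 \<le> R\<^sup>2" using le by (simp add: D_def distrib_right)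
  moreover have "(M * sqrt D)\<^sup>2 = D * M\<^sup>2" using D by (simp add: power_mult_distrib)
  ultimately have "(M * sqrt D)\<^sup>2 \<le> R\<^sup>2" by simp
  then have "M * sqrt D \<le> R" using R by (rule power2_le_imp_le)
  then have "M \<le> R / sqrt D" using D by (simp add: pos_le_divide_eq)
  then show ?thesis by (simp only: D_def)
qed

section \<open>Both convergence rates for the GFDPG iterates\<close>

theorem theorem5p1:
  fixes f :: "real^'n \<Rightarrow> ereal" and g :: "real^'m \<Rightarrow> ereal" and A :: "real^'n^'m"
    and \<sigma> :: real and L t :: "nat \<Rightarrow> real" and y w :: "nat \<Rightarrow> real^'m" and ystar :: "real^'m"
    and k :: nat
  assumes "ext_proper f" and "ext_closed f" and "ext_convex f"
    and "0 < \<sigma>" and "ext_strongly_convex \<sigma> f"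
    and "ext_proper g" and "ext_closed g" and "ext_convex g"
    and "\<forall>v. dual_q f g A v \<le> dual_q f g A ystar"
    and "gfdpg f g A L t y w"
    and "1 \<le> k"
  shows "dual_q f g A ystar - dual_q f g A (y k) = neg_dual_q f g A (y k) - neg_dual_q f g A ystar
    \<and> neg_dual_q f g A (y k) - neg_dual_q f g A ystar
        \<le> ereal (L k * (norm (y 0 - ystar))\<^sup>2 / (2 * T_sum t (k - 1)))
    \<and> (\<forall>L'. L k \<le> L' \<and> majorizes f g A L' (y k) \<longrightarrow>
          Min (insert (norm (p_step f g A L' (y k) - y k)) ((\<lambda>i. norm (y i - w (i - 1))) ` {1..k}))
            \<le> norm (y 0 - ystar) / sqrt ((\<Sum>i=0..k - 1. T_sum t i - (t i)\<^sup>2) + T_sum t (k - 1)))"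
proof -
  note fg = assms(1,2,4-8)
  define \<phi> where "\<phi> v = real_of_ereal (neg_dual_q f g A v)" for v
  \<comment> \<open>Off \<open>S\<close> the value \<infinity> of \<open>neg_dual_q\<close> is
    turned by \<open>real_of_ereal\<close> into the default 0, so \<open>\<phi>\<close> is
    meaningful on \<open>S\<close> only.\<close>
  define S where "S = {v. \<exists>a. dual_G g v = ereal a}"
  have Ffin: "\<exists>a. dual_F f A v = ereal a" for v
    by (rule exI, rule dual_F_finite_and_gradient_inequality(1)[OF fg(1-4)])
  have dq: "dual_q f g A v = ereal (- \<phi> v)" "neg_dual_q f g A v = ereal (\<phi> v)" if "v \<in> S" for v
    using that Ffin[of v] by (auto simp: S_def \<phi>_def neg_dual_q_def dual_q_def)
  have "ext_proper (dual_G g)" by (rule dual_G_regular[OF fg(5-7)])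
  then obtain v0 where "dual_G g v0 \<noteq> \<infinity>" and G: "\<And>v. dual_G g v \<noteq> -\<infinity>"
    unfolding ext_proper_def by blast
  then have v0: "v0 \<in> S" using G[of v0] by (cases "dual_G g v0") (auto simp: S_def)
  \<comment> \<open>Otherwise the dual value at \<open>ystar\<close> would be
    \<open>-\<infinity>\<close>, below the finite one at \<open>v0\<close>.\<close>
  have star: "ystar \<in> S"
  proof (rule ccontr)
    assume "ystar \<notin> S"
    then have "dual_G g ystar = \<infinity>" using G[of ystar] by (cases "dual_G g ystar") (auto simp: S_def)
    then have "dual_q f g A ystar = -\<infinity>" using Ffin[of ystar]
      by (auto simp: dual_q_def)
    moreover have "ereal (- \<phi> v0) \<le> dual_q f g A ystar" using spec[OF assms(9), of v0] unfolding dq(1)[OF v0] .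
    ultimately show False by simp
  qed
  have opt: "\<phi> ystar \<le> \<phi> v" if "v \<in> S" for v
    using spec[OF assms(9), of v] unfolding dq(1)[OF that] dq(1)[OF star] by simp
  have prox_S: "p_step f g A l v \<in> S" if "0 < l" for l v
    using p_step_minimizes(2)[OF fg that] by (simp add: S_def)
  have prox: "\<phi> (p_step f g A l v) + l / 2 * (norm (x - p_step f g A l v))\<^sup>2
      \<le> \<phi> x + l / 2 * (norm (x - v))\<^sup>2" if "0 < l" "majorizes f g A l v" "x \<in> S" for l v x
    using proximal_gradient_inequality[OF fg that(1,2), of x]
    unfolding dq(2)[OF that(3)] dq(2)[OF prox_S[OF that(1)]] by simp
  have init: "0 < L 0" "w 0 = y 0" "0 < t 0" "t 0 \<le> 1"
    using assms(10) by (simp_all add: gfdpg_def)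
  have iter: "L j \<le> L (Suc j)" "majorizes f g A (L (Suc j)) (w j)"
    "y (Suc j) = p_step f g A (L (Suc j)) (w j)" "0 < t (Suc j)" "(t (Suc j))\<^sup>2 \<le> T_sum t (Suc j)"
    "w (Suc j) = y (Suc j)
        + (((T_sum t j - t j) * t (Suc j)) / (t j * T_sum t (Suc j))) *\<^sub>R (y (Suc j) - y j)
        + ((((t j)\<^sup>2 - T_sum t j) * t (Suc j)) / (t j * T_sum t (Suc j))) *\<^sub>R (y (Suc j) - w j)" for j
  proof -
    \<comment> \<open>Four projections strip the initial conditions; the recursion for
      \<open>k \<ge> 1\<close> is then shifted to \<open>Suc j\<close>.\<close>
    note all = assms(10)[unfolded gfdpg_def, THEN conjunct2, THEN conjunct2, THEN conjunct2, THEN conjunct2]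
    have "1 \<le> Suc j" by simp
    note rec = all[THEN spec, THEN mp, OF this, unfolded diff_Suc_1]
    show "L j \<le> L (Suc j)" "majorizes f g A (L (Suc j)) (w j)"
      "y (Suc j) = p_step f g A (L (Suc j)) (w j)" "0 < t (Suc j)" "(t (Suc j))\<^sup>2 \<le> T_sum t (Suc j)"
      "w (Suc j) = y (Suc j)
        + (((T_sum t j - t j) * t (Suc j)) / (t j * T_sum t (Suc j))) *\<^sub>R (y (Suc j) - y j)
        + ((((t j)\<^sup>2 - T_sum t j) * t (Suc j)) / (t j * T_sum t (Suc j))) *\<^sub>R (y (Suc j) - w j)"
      using rec by blast+
  qed
  have Lpos: "0 < L j" for j by (induction j) (use init(1) iter(1) in \<open>auto intro: less_le_trans\<close>)
  have tpos: "0 < t j" for j using init(3) iter(4) by (cases j) auto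
  have tT: "(t j)\<^sup>2 \<le> T_sum t j" for j
  proof (cases j)
    case 0
    \<comment> \<open>For \<open>j = 0\<close> the bound comes from \<open>t 0 \<le> 1\<close> and
      \<open>T_sum t 0 = t 0\<close>.\<close>
    then show ?thesis using init(3,4) by (simp add: power2_eq_square mult_left_le T_sum_def)
  next
    case (Suc i)
    then show ?thesis using iter(5)[of i] by simp
  qed
  have Tpos: "0 < T_sum t j" for j unfolding T_sum_def using tpos by (intro sum_pos) auto
  have y_S: "y (Suc j) \<in> S" for j using prox_S[OF Lpos] iter(3) by simp
  obtain n where k: "k = Suc n" using assms(11) by (cases k) auto
  define R where "R = norm (y 0 - ystar)"
  define \<delta> where "\<delta> = \<phi> (y k) - \<phi> ystar"
  define V where "V = (\<Sum>i<k. (T_sum t i - (t i)\<^sup>2) * (norm (y (Suc i) - w i))\<^sup>2)"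
  have "2 / L k * (T_sum t k - t k) * \<delta> + V \<le> R\<^sup>2"
    unfolding \<delta>_def V_def R_def
  proof (rule gfdpg_lyapunov[where L = L and t = t and y = y and w = w and S = S and \<phi> = \<phi> and x = ystar,
      OF init(1) iter(1) tpos init(2) iter(6) _ y_S star opt])
    show "\<phi> (y (Suc j)) + L (Suc j) / 2 * (norm (x - y (Suc j)))\<^sup>2
        \<le> \<phi> x + L (Suc j) / 2 * (norm (x - w j))\<^sup>2" if "x \<in> S" for j x
      unfolding iter(3) by (rule prox[OF Lpos iter(2) that])
  qed
  \<comment> \<open>With \<open>k = Suc n\<close>, the coefficient \<open>T_sum t k - t k\<close> is
    \<open>T_sum t n\<close>.\<close>
  then have lyap: "2 / L k * T_sum t n * \<delta> + V \<le> R\<^sup>2" by (simp add: k T_sum_def)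
  have V0: "0 \<le> V" unfolding V_def using tT by (intro sum_nonneg) auto
  have yk: "y k \<in> S" using y_S k by simp
  have "2 / L k * T_sum t n * \<delta> \<le> R\<^sup>2" using lyap V0 by linarith
  then have gap: "\<delta> \<le> L k * R\<^sup>2 / (2 * T_sum t n)"
    using Lpos[of k] Tpos[of n] by (simp add: field_simps)
  have best: "Min (insert (norm (p_step f g A L' (y k) - y k)) ((\<lambda>i. norm (y i - w (i - 1))) ` {1..k}))
            \<le> R / sqrt ((\<Sum>i=0..k - 1. T_sum t i - (t i)\<^sup>2) + T_sum t (k - 1))"
      (is "?M \<le> R / sqrt ?D") if L': "L k \<le> L'" "majorizes f g A L' (y k)" for L'
  proof -
    define p where "p = p_step f g A L' (y k)"
    have "0 < L'" using L' Lpos[of k] by linarith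
    \<comment> \<open>The proximal inequality with \<open>x = y k\<close> as its own center bounds
      the extra step length by the gap \<open>\<delta>\<close>.\<close>
    then have "p \<in> S" and "\<phi> p + L' / 2 * (norm (y k - p))\<^sup>2 \<le> \<phi> (y k)"
      using prox_S prox[OF _ L'(2) yk] by (auto simp: p_def)
    then have "L' / 2 * (norm (p - y k))\<^sup>2 \<le> \<delta>"
      using opt[of p] by (simp add: \<delta>_def norm_minus_commute)
    \<comment> \<open>\<open>L k \<le> L'\<close> is used here: lowering the coefficient to
      \<open>L k / 2\<close> matches the factor \<open>2 / L k\<close> in
      \<open>lyap\<close>.\<close>
    moreover have "L k / 2 * (norm (p - y k))\<^sup>2 \<le> L' / 2 * (norm (p - y k))\<^sup>2"
      using L' by (intro mult_right_mono) auto
    ultimately have "L k / 2 * (norm (p - y k))\<^sup>2 \<le> \<delta>" by linarith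
    then have "2 / L k * T_sum t n * (L k / 2 * (norm (p - y k))\<^sup>2) \<le> 2 / L k * T_sum t n * \<delta>"
      using Lpos[of k] Tpos[of n] by (intro mult_left_mono) auto
    moreover have "2 / L k * T_sum t n * (L k / 2 * (norm (p - y k))\<^sup>2) = T_sum t n * (norm (p - y k))\<^sup>2"
      using Lpos[of k] by simp
    ultimately have last: "T_sum t n * (norm (p - y k))\<^sup>2 + V \<le> R\<^sup>2" using lyap by linarith
    \<comment> \<open>\<open>k - 1\<close> is truncated subtraction; the two index sets agree
      because \<open>k\<close> is a successor.\<close>
    have idx: "{0..k - 1} = {..<k}" using k by auto
    show ?thesis
      unfolding idx
    proof (rule le_of_weighted_square_sum)
      show "(\<Sum>i<k. (T_sum t i - (t i)\<^sup>2) * (norm (y (Suc i) - w i))\<^sup>2)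
          + T_sum t (k - 1) * (norm (p - y k))\<^sup>2 \<le> R\<^sup>2"
        using last by (simp add: k V_def)
      show "?M \<le> norm (p - y k)" by (intro Min_le) (auto simp: p_def)
      \<comment> \<open>The sum index \<open>i\<close> corresponds to the index \<open>Suc i\<close>
        of the minimum.\<close>
      show "?M \<le> norm (y (Suc i) - w i)" if "i \<in> {..<k}" for i
        using that by (intro Min_le insertI2 image_eqI[of _ _ "Suc i"]) auto
      show "0 \<le> ?M" by (intro Min.boundedI) auto
    qed (use tT Tpos in \<open>simp_all add: R_def\<close>)
  qed
  have "k - 1 = n" using k by simp
  then have "\<phi> (y k) - \<phi> ystar \<le> L k * (norm (y 0 - ystar))\<^sup>2 / (2 * T_sum t (k - 1))"
    using gap by (simp only: \<delta>_def R_def)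
  moreover have "- \<phi> ystar - - \<phi> (y k) = \<phi> (y k) - \<phi> ystar" by simp
  ultimately show ?thesis
    using best unfolding dq(1)[OF star] dq(1)[OF yk] dq(2)[OF star] dq(2)[OF yk]
      ereal_minus(1) ereal_less_eq(3) ereal.inject R_def by blast
qed

end
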